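(* Let $C \in \mathcal K^n$ be Minkowski centered. Then the following are equivalent: (i) $C \cap (-C) \subset^{opt} \mathrm{conv}(C \cup (-C))$, (ii) $\left(\frac12 (C^\circ-C^\circ) \right)^{\circ}\subset^{opt} \frac12 (C-C)$, (iii) there exist points $p, -p \in \mathrm{bd}(C)$ and parallel halfspaces $H^{\le}_{a,\rho}$ and $H^{\le}_{-a,\rho}$ (with $a\in\mathbb R^n\setminus\{0\}$, $\rho\in\mathbb R$) supporting $C$ at $p$ and $-p$, respectively.
   Context: $\mathcal K^n$ denotes the set of convex bodies in $\mathbb R^n$, i.e. full-dimensional compact convex sets. $\mathrm{conv}(X)$ is the convex hull and $\mathrm{bd}(X)$ the boundary of $X$. For $K,C\subset\mathbb R^n$ and $\rho\in\mathbb R$: $K+C=\{a+b:a\in K,b\in C\}$, $\rho C=\{\rho x:x\in C\}$, $-C=(-1)C$, and $K-C=K+(-C)$ (so $C^\circ-C^\circ=C^\circ+(-C^\circ)$). For $K\in\mathcal K^n$, $K^\circ=\{a\in\mathbb R^n: a^Tx\le 1 \text{ for all } x\in K\}$ is the polar of $K$. For $a\in\mathbb R^n\setminus\{0\}$ and $\rho\in\mathbb R$, $H^{\le}_{a,\rho}=\{x\in\mathbb R^n:a^Tx\le\rho\}$. The halfspace $H^{\le}_{a,\rho}$ supports $C\in\mathcal K^n$ at $q\in C$ if $C\subset H^{\le}_{a,\rho}$ and $q\in\mathrm{bd}(H^{\le}_{a,\rho})$. Optimal containment: for $K,C\in\mathcal K^n$, $K\subset^{opt}C$ means that $K\subset C$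 and $K\not\subset t+\rho C$ for any $0\le\rho<1$ and $t\in\mathbb R^n$. Minkowski asymmetry: $s(C):=\inf\{\rho>0: C-c\subset\rho(c-C) \text{ for some } c\in\mathbb R^n\}$. A Minkowski center of $C$ is any $c\in\mathbb R^n$ with $C-c\subset s(C)(c-C)$. $C$ is Minkowski centered if $0$ is a Minkowski center of $C$, i.e. $C\subset -s(C)\,C$. *)

theory Defs
  imports "HOL-Analysis.Analysis" "HOL-Library.Set_Algebras"
begin

text \<open>
  On sets, \<open>+\<close> is the Minkowski sum of \<open>Set_Algebras\<close>, but unary and binary \<open>-\<close> are
  complement and set difference. The reflection, the Minkowski difference and the
  dilatation of a set therefore get names of their own.
\<close>

definition set_neg :: "'a::real_vector set \<Rightarrow> 'a set" where
  "set_neg C = uminus ` C"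

definition minkowski_diff :: "'a::real_vector set \<Rightarrow> 'a set \<Rightarrow> 'a set" where
  "minkowski_diff K C = K + set_neg C"

definition dilate :: "real \<Rightarrow> 'a::real_vector set \<Rightarrow> 'a set" where
  "dilate \<rho> C = (\<lambda>x. \<rho> *\<^sub>R x) ` C"

definition convex_body :: "'a::euclidean_space set \<Rightarrow> bool" where
  "convex_body K \<longleftrightarrow> compact K \<and> convex K \<and> aff_dim K = int (DIM('a))"

definition polar :: "'a::real_inner set \<Rightarrow> 'a set" where
  "polar K = {a. \<forall>x\<in>K. a \<bullet> x \<le> 1}"

definition halfspace_le :: "'a::real_inner \<Rightarrow> real \<Rightarrow> 'a set" where
  "halfspace_le a \<rho> = {x. a \<bullet> x \<le> \<rho>}"

definition supports_at :: "'a::real_inner set \<Rightarrow> 'a set \<Rightarrow> 'a \<Rightarrow> bool" where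
  "supports_at H C q \<longleftrightarrow> q \<in> C \<and> C \<subseteq> H \<and> q \<in> frontier H"

definition opt_contained :: "'a::real_vector set \<Rightarrow> 'a set \<Rightarrow> bool" where
  "opt_contained K C \<longleftrightarrow>
     K \<subseteq> C \<and> (\<forall>\<rho> t. 0 \<le> \<rho> \<and> \<rho> < 1 \<longrightarrow> \<not> K \<subseteq> {t} + dilate \<rho> C)"

definition minkowski_asymmetry :: "'a::real_vector set \<Rightarrow> real" where
  "minkowski_asymmetry C =
     Inf {\<rho>. \<rho> > 0 \<and> (\<exists>c. minkowski_diff C {c} \<subseteq> dilate \<rho> (minkowski_diff {c} C))}"

definition minkowski_center :: "'a::real_vector set \<Rightarrow> 'a \<Rightarrow> bool" where
  "minkowski_center C c \<longleftrightarrow>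
     minkowski_diff C {c} \<subseteq> dilate (minkowski_asymmetry C) (minkowski_diff {c} C)"

definition minkowski_centered :: "'a::real_vector set \<Rightarrow> bool" where
  "minkowski_centered C \<longleftrightarrow> minkowski_center C 0"

end

theory Submission
  imports Defs
begin

text \<open>
  Each of the three conditions says that some \<open>p\<close> with \<open>p, -p \<in> C\<close> and some \<open>a \<noteq> 0\<close>
  satisfy \<open>\<bar>a \<bullet> y\<bar> \<le> a \<bullet> p\<close> on \<open>C\<close>. Optimality of \<open>K \<subseteq> D\<close> makes \<open>K\<close> touch the
  boundary of \<open>D\<close>, since otherwise \<open>D\<close> could be shrunk. For (i), a hyperplane supporting
  \<open>conv (C \<union> -C)\<close> at a touching point also supports \<open>C\<close> and \<open>-C\<close>. For (ii), let \<open>\<alpha>, \<beta>\<close> be the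
  values of the support function of \<open>C\<close> at \<open>a, -a\<close>; then \<open>a/\<alpha>, -a/\<beta> \<in> C\<degree>\<close> bounds \<open>a \<bullet> x\<close>
  on the harmonic mean of \<open>C\<close> and \<open>-C\<close> by the harmonic mean of \<open>\<alpha>, \<beta>\<close>, while on
  \<open>(C - C)/2\<close> its maximum is \<open>(\<alpha> + \<beta>)/2\<close>. Equality at a touching point forces \<open>\<alpha> = \<beta>\<close>.
  Centeredness enters only through \<open>0 \<in> interior C\<close>.
\<close>

section \<open>Membership rules and closure properties for means and polars\<close>

lemma mem_set_neg [simp]: "x \<in> set_neg C \<longleftrightarrow> - x \<in> C"
  by (force simp: set_neg_def)

lemma mem_minkowski_diff: "x \<in> minkowski_diff K C \<longleftrightarrow> (\<exists>y\<in>K. \<exists>z\<in>C. x = y - z)"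
  unfolding minkowski_diff_def set_plus_def set_neg_def by force

lemma mem_dilate: "x \<in> dilate \<rho> C \<longleftrightarrow> (\<exists>y\<in>C. x = \<rho> *\<^sub>R y)"
  by (auto simp: dilate_def)

lemma mem_half_diff:
  "x \<in> dilate (1/2) (minkowski_diff K C) \<longleftrightarrow> (\<exists>y\<in>K. \<exists>z\<in>C. x = (1/2) *\<^sub>R (y - z))"
  unfolding mem_dilate Bex_def mem_minkowski_diff by blast

lemma mem_polar_half_diff:
  "x \<in> polar (dilate (1/2) (minkowski_diff K C)) \<longleftrightarrow> (\<forall>u\<in>K. \<forall>v\<in>C. u \<bullet> x - v \<bullet> x \<le> 2)"
proof -
  have "x \<bullet> ((1/2) *\<^sub>R (u - v)) \<le> 1 \<longleftrightarrow> u \<bullet> x - v \<bullet> x \<le> 2" for u v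
    by (simp add: inner_diff_right inner_commute)
  then show ?thesis
    unfolding polar_def Ball_def mem_Collect_eq mem_half_diff by blast
qed

lemma closed_polar: "closed (polar K)"
proof -
  have "polar K = (\<Inter>x\<in>K. {a. x \<bullet> a \<le> 1})"
    by (auto simp: polar_def inner_commute)
  then show ?thesis
    by (simp add: closed_INT closed_halfspace_le)
qed

lemma convex_half_diff:
  assumes "convex C"
  shows "convex (dilate (1/2) (minkowski_diff C C))"
  unfolding dilate_def minkowski_diff_def set_neg_def
  using assms by (intro convex_scaling convex_set_plus convex_negations)

lemma compact_half_diff:
  fixes C :: "'a::real_normed_vector set"
  assumes "compact C"
  shows "compact (dilate (1/2) (minkowski_diff C C))"
proof -
  have "minkowski_diff C C = {x - y |x y. x \<in> C \<and> y \<in> C}"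
    unfolding set_eq_iff mem_Collect_eq mem_minkowski_diff by blast
  then show ?thesis
    unfolding dilate_def using assms by (simp add: compact_scaling compact_differences)
qed

section \<open>Linear functionals at interior points\<close>

lemma inner_pos_of_zero_interior:
  fixes a :: "'a::euclidean_space"
  assumes "0 \<in> interior C" "a \<noteq> 0"
  obtains y where "y \<in> C" "a \<bullet> y > 0"
proof -
  obtain e where e: "e > 0" "cball 0 e \<subseteq> C"
    using assms(1) by (auto simp: mem_interior_cball)
  let ?y = "(e / norm a) *\<^sub>R a"
  have "?y \<in> C"
    using e assms(2) by (auto simp: subset_iff)
  moreover have "a \<bullet> ?y > 0"
    using e assms(2) by simp
  ultimately show thesis by (rule that)
qed

lemma not_interior_of_maximal:
  fixes a :: "'a::euclidean_space"
  assumes "a \<noteq> 0" "\<forall>x\<in>C. a \<bullet> x \<le> a \<bullet> p"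
  shows "p \<notin> interior C"
proof
  assume "p \<in> interior C"
  then obtain e where e: "e > 0" "cball p e \<subseteq> C"
    by (auto simp: mem_interior_cball)
  let ?y = "p + (e / norm a) *\<^sub>R a"
  have "?y \<in> C"
    using e assms(1) by (auto simp: subset_iff dist_norm)
  then have "(e / norm a) * (a \<bullet> a) \<le> 0"
    using assms(2) by (force simp: inner_add_right)
  then show False
    using assms(1) e by (simp add: mult_le_0_iff divide_simps) (metis inner_gt_zero_iff not_le)
qed

section \<open>Minkowski centered bodies have the origin in their interior\<close>

text \<open>A real \<open>Inf\<close> inherits the lower bound 0 only from a nonempty set, so an
  admissible ratio must be exhibited.\<close>

lemma minkowski_asymmetry_nonneg:
  fixes C :: "'a::euclidean_space set"
  assumes "bounded C" "interior C \<noteq> {}"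
  shows "minkowski_asymmetry C \<ge> 0"
proof -
  obtain c e where e: "e > 0" "cball c e \<subseteq> C"
    using assms(2) by (auto simp: mem_interior_cball)
  obtain B where B: "B > 0" "\<forall>x\<in>C. norm x \<le> B"
    using assms(1) bounded_pos by blast
  \<comment> \<open>Every y - c with y in \<open>C\<close> has norm at most B + |c|; dividing by
    \<open>r\<close> brings it into the ball of radius \<open>e\<close>, so reflecting the result
    about \<open>c\<close> stays in \<open>C\<close>.\<close>
  define r where "r = (B + norm c) / e"
  have r: "r > 0"
    unfolding r_def using e B by (simp add: add_pos_nonneg)
  have "minkowski_diff C {c} \<subseteq> dilate r (minkowski_diff {c} C)"
  proof
    fix x assume "x \<in> minkowski_diff C {c}"
    then obtain y where y: "y \<in> C" "x = y - c"
      by (auto simp: mem_minkowski_diff)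
    have "norm x \<le> r * e"
      unfolding r_def y(2) using e B y norm_triangle_ineq4[of y c] by fastforce
    then have "norm ((1/r) *\<^sub>R x) \<le> e"
      using r by (simp add: divide_simps mult.commute)
    then have "c - (1/r) *\<^sub>R x \<in> C"
      using e(2) by (auto simp: subset_iff dist_norm)
    moreover have "x = r *\<^sub>R (c - (c - (1/r) *\<^sub>R x))"
      using r by simp
    ultimately show "x \<in> dilate r (minkowski_diff {c} C)"
      unfolding mem_dilate Bex_def mem_minkowski_diff by blast
  qed
  then show ?thesis
    unfolding minkowski_asymmetry_def using r by (intro cInf_greatest) auto
qed

lemma convex_body_interior_nonempty:
  fixes C :: "'a::euclidean_space set"
  assumes "convex_body C"
  shows "interior C \<noteq> {}"
proof -
  have "convex C" "aff_dim C = int (DIM('a))"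
    using assms by (auto simp: convex_body_def)
  moreover have "C \<noteq> {}"
    using calculation(2) by auto
  ultimately show ?thesis
    by (metis aff_dim_eq_full interior_rel_interior_gen rel_interior_eq_empty)
qed

text \<open>Otherwise some hyperplane through 0 has \<open>C\<close> on one side. Since
  \<open>C\<close> lies in -sC with s \<ge> 0, it is also on the other side, hence inside the
  hyperplane, which contradicts its nonempty interior.\<close>

lemma minkowski_centered_zero_interior:
  assumes "convex_body C" "minkowski_centered C"
  shows "0 \<in> interior C"
proof (rule ccontr)
  assume 0: "0 \<notin> interior C"
  have C: "compact C" "convex C"
    using assms(1) by (auto simp: convex_body_def)
  have int: "interior C \<noteq> {}"
    using assms(1) by (rule convex_body_interior_nonempty)
  define s where "s = minkowski_asymmetry C"
  have s: "s \<ge> 0"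
    unfolding s_def using C int by (simp add: minkowski_asymmetry_nonneg compact_imp_bounded)
  \<comment> \<open>The origin may lie in \<open>C\<close> itself, so the interior is separated from
    it; the bound then passes to \<open>C\<close> by closure.\<close>
  obtain a b where a: "a \<noteq> 0" "\<forall>x\<in>interior C. a \<bullet> x \<le> b" "b \<le> a \<bullet> 0"
    using separating_hyperplane_sets[of "interior C" "{0}"] C int 0
    by (auto simp: convex_interior)
  have le: "a \<bullet> x \<le> 0" if "x \<in> C" for x
  proof -
    have "closure (interior C) \<subseteq> {x. a \<bullet> x \<le> b}"
      using a by (intro closure_minimal closed_halfspace_le) auto
    moreover have "x \<in> closure (interior C)"
      using that C int convex_closure_interior closure_subset by blast
    ultimately show ?thesis using a by auto
  qed
  have sub: "\<exists>z\<in>C. x = - (s *\<^sub>R z)" if "x \<in> C" for x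
  proof -
    have "x \<in> minkowski_diff C {0}"
      using that by (auto simp: mem_minkowski_diff)
    then have "x \<in> dilate s (minkowski_diff {0} C)"
      using assms(2) by (auto simp: minkowski_centered_def minkowski_center_def s_def)
    then obtain z where "z \<in> C" "x = s *\<^sub>R (0 - z)"
      unfolding mem_dilate Bex_def mem_minkowski_diff by blast
    then show ?thesis by auto
  qed
  have eq: "a \<bullet> x = 0" if x: "x \<in> C" for x
  proof -
    obtain z where z: "z \<in> C" "x = - (s *\<^sub>R z)"
      using sub[OF x] by blast
    have "a \<bullet> x \<ge> 0"
      using z s le[of z] by (simp add: mult_nonneg_nonpos)
    then show ?thesis using le[OF x] by simp
  qed
  obtain p where p: "p \<in> interior C" using int by blast
  then have "a \<bullet> p = 0" using eq interior_subset by blast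
  then have "p \<notin> interior C"
    using a(1) eq by (intro not_interior_of_maximal[of a]) auto
  then show False using p by blast
qed

section \<open>Optimal containment: touching points and a sufficient condition\<close>

text \<open>A compact \<open>K\<close> inside the interior of \<open>D\<close> has room to be
  enlarged slightly about the origin, so it fits into a shrunken \<open>D\<close>. Optimality thus
  leaves a point of \<open>K\<close> outside the interior, where a supporting hyperplane
  exists.\<close>

lemma opt_contained_imp_touching:
  fixes D :: "'a::euclidean_space set"
  assumes opt: "opt_contained K D" and K: "compact K"
    and D: "convex D" "interior D \<noteq> {}"
  obtains a p where "a \<noteq> 0" "p \<in> K" "\<forall>x\<in>D. a \<bullet> x \<le> a \<bullet> p"
proof -
  have sub: "K \<subseteq> D" using opt by (simp add: opt_contained_def)
  have "\<not> K \<subseteq> interior D"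
  proof
    assume "K \<subseteq> interior D"
    then obtain e where e: "e > 0" "(\<Union>x\<in>K. ball x e) \<subseteq> interior D"
      using compact_subset_open_imp_ball_epsilon_subset K by (metis open_interior)
    obtain B where B: "B > 0" "\<forall>x\<in>K. norm x \<le> B"
      using K compact_imp_bounded bounded_pos by blast
    \<comment> \<open>Scaling by 1 + d moves each point of \<open>K\<close> by at most d B =
      e/2.\<close>
    define d where "d = e / (2 * B)"
    have d: "d > 0" using e B by (simp add: d_def)
    have "K \<subseteq> {0} + dilate (1 / (1 + d)) D"
    proof
      fix x assume x: "x \<in> K"
      have "norm (d *\<^sub>R x) \<le> d * B"
        using B d x by simp
      also have "\<dots> < e" using e B by (simp add: d_def)
      finally have "(1 + d) *\<^sub>R x \<in> ball x e"
        by (simp add: dist_norm algebra_simps)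
      then have "(1 + d) *\<^sub>R x \<in> D"
        using e x interior_subset by blast
      moreover have "x = (1 / (1 + d)) *\<^sub>R ((1 + d) *\<^sub>R x)"
        using d by simp
      ultimately show "x \<in> {0} + dilate (1 / (1 + d)) D"
        unfolding set_plus_def by (force simp: mem_dilate)
    qed
    moreover have "0 \<le> 1 / (1 + d)" "1 / (1 + d) < 1" using d by auto
    ultimately show False using opt unfolding opt_contained_def by blast
  qed
  then obtain p where p: "p \<in> K" "p \<notin> rel_interior D"
    using rel_interior_nonempty_interior[OF D(2)] by auto
  then obtain a where "a \<noteq> 0" "\<And>y. y \<in> D \<Longrightarrow> a \<bullet> p \<le> a \<bullet> y"
    using supporting_hyperplane_rel_boundary[OF D(1)] sub by (metis subsetD)
  then show thesis
    using p by (intro that[of "- a" p]) auto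
qed

text \<open>Compare widths in direction \<open>a\<close>: that of \<open>K\<close> is at least 2 (a
  \<bullet> p), while that of a translate of rD is at most r times this value.\<close>

lemma opt_containedI_antipodal:
  assumes "K \<subseteq> D" "p \<in> K" "- p \<in> K" "a \<bullet> p > 0" "\<forall>x\<in>D. \<bar>a \<bullet> x\<bar> \<le> a \<bullet> p"
  shows "opt_contained K D"
  unfolding opt_contained_def
proof (intro conjI allI impI notI)
  fix r t assume r: "0 \<le> r \<and> r < 1" and sub: "K \<subseteq> {t} + dilate r D"
  obtain y where y: "y \<in> D" "p = t + r *\<^sub>R y"
    using sub assms(2) by (auto simp: set_plus_def mem_dilate dest!: subsetD)
  obtain z where z: "z \<in> D" "- p = t + r *\<^sub>R z"
    using sub assms(3) by (force simp: set_plus_def mem_dilate dest!: subsetD)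
  \<comment> \<open>Subtracting the two representations eliminates the translation
    \<open>t\<close>.\<close>
  have "p - - p = (t + r *\<^sub>R y) - (t + r *\<^sub>R z)"
    using y z by (simp only:)
  then have "2 *\<^sub>R p = r *\<^sub>R (y - z)"
    by (simp add: scaleR_2 scaleR_diff_right)
  then have "2 * (a \<bullet> p) = r * (a \<bullet> y - a \<bullet> z)"
    by (metis inner_diff_right inner_scaleR_right)
  also have "\<dots> \<le> r * (2 * (a \<bullet> p))"
  proof (rule mult_left_mono)
    have "\<bar>a \<bullet> y\<bar> \<le> a \<bullet> p" "\<bar>a \<bullet> z\<bar> \<le> a \<bullet> p"
      using assms(5) y(1) z(1) by blast+
    then show "a \<bullet> y - a \<bullet> z \<le> 2 * (a \<bullet> p)" by linarith
  qed (use r in simp)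
  also have "\<dots> < 1 * (2 * (a \<bullet> p))"
    using assms(4) r by (intro mult_strict_right_mono) auto
  finally show False by simp
qed (use assms in auto)

section \<open>Polarity and the harmonic and arithmetic means of C and -C\<close>

text \<open>The nontrivial inclusion of the bipolar theorem.\<close>

lemma mem_of_polar_bound:
  fixes C :: "'a::euclidean_space set"
  assumes C: "closed C" "convex C" "0 \<in> C" and w: "\<forall>w\<in>polar C. w \<bullet> x \<le> 1"
  shows "x \<in> C"
proof (rule ccontr)
  assume "x \<notin> C"
  then obtain a b where ab: "a \<bullet> x < b" "\<forall>y\<in>C. a \<bullet> y > b"
    using separating_hyperplane_closed_point[OF C(2,1)] by blast
  then have b: "b < 0" using C(3) by force
  \<comment> \<open>Dividing by b < 0 reverses both inequalities: a/b stays below 1 on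
    \<open>C\<close> but exceeds 1 at \<open>x\<close>.\<close>
  have "(1/b) *\<^sub>R a \<in> polar C"
    using ab b by (auto simp: polar_def divide_simps less_imp_le)
  then have "((1/b) *\<^sub>R a) \<bullet> x \<le> 1" using w by blast
  then show False using ab b by (simp add: divide_simps)
qed

text \<open>Here \<alpha> and \<beta> are the maxima of \<open>a\<close> and -a on \<open>C\<close>,
  positive because 0 is interior. The level \<rho> is kept free: it is a separating level in the
  inclusion proof and a \<bullet> x at a touching point.\<close>

lemma harmonic_mean_support:
  fixes C :: "'a::euclidean_space set"
  assumes C: "compact C" "0 \<in> interior C" and a: "a \<noteq> 0"
    and x: "x \<in> polar (dilate (1/2) (minkowski_diff (polar C) (polar C)))"
    and M: "\<forall>y\<in>dilate (1/2) (minkowski_diff C C). a \<bullet> y \<le> \<rho>"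
  obtains \<alpha> \<beta> where "\<alpha> > 0" "\<beta> > 0" "\<alpha> + \<beta> \<le> 2 * \<rho>"
    "(1/\<alpha>) *\<^sub>R a \<in> polar C" "- ((1/\<beta>) *\<^sub>R a) \<in> polar C"
    "\<forall>y\<in>C. a \<bullet> y \<le> \<alpha> \<and> - (a \<bullet> y) \<le> \<beta>" "(a \<bullet> x) * (\<alpha> + \<beta>) \<le> 2 * \<alpha> * \<beta>"
proof -
  have ne: "C \<noteq> {}" and cont: "continuous_on C (\<lambda>y. a \<bullet> y)"
    using C interior_subset by (auto intro: continuous_intros)
  obtain y where y: "y \<in> C" "\<forall>x\<in>C. a \<bullet> x \<le> a \<bullet> y"
    using continuous_attains_sup[OF C(1) ne cont] by blast
  obtain z where z: "z \<in> C" "\<forall>x\<in>C. a \<bullet> z \<le> a \<bullet> x"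
    using continuous_attains_inf[OF C(1) ne cont] by blast
  have pos: "a \<bullet> y > 0"
    using inner_pos_of_zero_interior[OF C(2) a] y by (metis less_le_trans)
  have neg: "- (a \<bullet> z) > 0"
    using inner_pos_of_zero_interior[OF C(2), of "- a"] a z
    by (metis inner_minus_left neg_0_equal_iff_equal neg_le_iff_le less_le_trans)
  \<comment> \<open>The two extremal points realize the value (\<alpha> + \<beta>)/2 on the
    arithmetic mean.\<close>
  have "(1/2) *\<^sub>R (y - z) \<in> dilate (1/2) (minkowski_diff C C)"
    using y z by (auto simp: mem_half_diff)
  then have "a \<bullet> y + - (a \<bullet> z) \<le> 2 * \<rho>"
    using M by (fastforce simp: inner_diff_right)
  moreover have u: "(1 / (a \<bullet> y)) *\<^sub>R a \<in> polar C"
    using y pos by (auto simp: polar_def divide_simps)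
  moreover have v: "- ((1 / (- (a \<bullet> z))) *\<^sub>R a) \<in> polar C"
    using z neg by (auto simp: polar_def divide_simps)
  moreover have "(a \<bullet> x) * (a \<bullet> y + - (a \<bullet> z)) \<le> 2 * (a \<bullet> y) * - (a \<bullet> z)"
  proof -
    \<comment> \<open>Test \<open>x\<close> against the polar pair a/\<alpha>, -a/\<beta>.\<close>
    have "(1 / (a \<bullet> y)) * (a \<bullet> x) + (1 / (- (a \<bullet> z))) * (a \<bullet> x) \<le> 2"
      using x u v unfolding mem_polar_half_diff by fastforce
    moreover have "m * (\<alpha> + \<beta>) \<le> 2 * \<alpha> * \<beta>"
      if "\<alpha> > 0" "\<beta> > 0" "(1/\<alpha>) * m + (1/\<beta>) * m \<le> 2" for m \<alpha> \<beta> :: real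
      using that by (simp add: field_simps)
    ultimately show ?thesis using pos neg by blast
  qed
  ultimately show thesis
    using y z pos neg by (intro that[of "a \<bullet> y" "- (a \<bullet> z)"]) auto
qed

text \<open>The harmonic-arithmetic mean inequality and its equality case, for \<open>m\<close>
  bounded by the harmonic mean; both rest on (\<alpha> + \<beta>)^2 - 4 \<alpha> \<beta> = (\<alpha>
  - \<beta>)^2.\<close>

lemma harmonic_mean_le:
  fixes \<alpha> \<beta> m :: real
  assumes "\<alpha> > 0" "\<beta> > 0" "m * (\<alpha> + \<beta>) \<le> 2 * \<alpha> * \<beta>"
  shows "2 * m \<le> \<alpha> + \<beta>"
    and "\<alpha> + \<beta> \<le> 2 * m \<Longrightarrow> \<alpha> = m \<and> \<beta> = m"
proof -
  have sq: "(\<alpha> + \<beta>) * (\<alpha> + \<beta>) - 4 * \<alpha> * \<beta> = (\<alpha> - \<beta>)\<^sup>2"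
    by (simp add: power2_eq_square algebra_simps)
  have "(2 * m) * (\<alpha> + \<beta>) \<le> (\<alpha> + \<beta>) * (\<alpha> + \<beta>)"
    using assms(3) sq zero_le_power2[of "\<alpha> - \<beta>"] by linarith
  then show le: "2 * m \<le> \<alpha> + \<beta>"
    using assms(1,2) by (simp add: mult_le_cancel_right)
  assume "\<alpha> + \<beta> \<le> 2 * m"
  with le have m: "2 * m = \<alpha> + \<beta>" by simp
  then have "2 * m * (\<alpha> + \<beta>) = (\<alpha> + \<beta>) * (\<alpha> + \<beta>)" by simp
  then have "(\<alpha> - \<beta>)\<^sup>2 \<le> 0" using sq assms(3) by linarith
  then show "\<alpha> = m \<and> \<beta> = m" using m by auto
qed

text \<open>If a hyperplane separated \<open>x\<close> from the arithmetic mean, then -a \<bullet> x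
  > -b \<ge> (\<alpha> + \<beta>)/2, against the mean inequality.\<close>

lemma harmonic_mean_subset_arithmetic_mean:
  fixes C :: "'a::euclidean_space set"
  assumes C: "compact C" "convex C" "0 \<in> interior C"
  shows "polar (dilate (1/2) (minkowski_diff (polar C) (polar C)))
    \<subseteq> dilate (1/2) (minkowski_diff C C)"
proof
  fix x assume x: "x \<in> polar (dilate (1/2) (minkowski_diff (polar C) (polar C)))"
  let ?M = "dilate (1/2) (minkowski_diff C C)"
  have 0: "0 \<in> ?M" using C(3) interior_subset by (force simp: mem_half_diff)
  show "x \<in> ?M"
  proof (rule ccontr)
    assume "x \<notin> ?M"
    then obtain a b where ab: "a \<bullet> x < b" "\<forall>y\<in>?M. a \<bullet> y > b"
      using separating_hyperplane_closed_point[of ?M x] C convex_half_diff compact_half_diff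
        compact_imp_closed by blast
    \<comment> \<open>For a = 0, the separation would give 0 < b at \<open>x\<close> and 0 > b at
      the origin.\<close>
    have a: "- a \<noteq> 0" using ab 0 by force
    have M: "\<forall>y\<in>?M. (- a) \<bullet> y \<le> - b" using ab by (auto intro: less_imp_le)
    obtain \<alpha> \<beta> where "\<alpha> > 0" "\<beta> > 0" "\<alpha> + \<beta> \<le> 2 * - b"
      "(- a \<bullet> x) * (\<alpha> + \<beta>) \<le> 2 * \<alpha> * \<beta>"
      by (rule harmonic_mean_support[OF C(1,3) a x M]) blast
    then show False
      using harmonic_mean_le(1)[of \<alpha> \<beta> "- a \<bullet> x"] ab by simp
  qed
qed

text \<open>Taking \<rho> = a \<bullet> x forces equality of the means, so \<alpha> = \<beta> = a
  \<bullet> x. One half of the test pair then has value 1 or -1 at \<open>x\<close>, leaving a bound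
  on the other half alone, and the bipolar inclusion applies.\<close>

lemma harmonic_mean_touching:
  fixes C :: "'a::euclidean_space set"
  assumes C: "compact C" "convex C" "0 \<in> interior C" and a: "a \<noteq> 0"
    and x: "x \<in> polar (dilate (1/2) (minkowski_diff (polar C) (polar C)))"
    and M: "\<forall>y\<in>dilate (1/2) (minkowski_diff C C). a \<bullet> y \<le> a \<bullet> x"
  shows "x \<in> C" "- x \<in> C" "\<forall>y\<in>C. \<bar>a \<bullet> y\<bar> \<le> a \<bullet> x"
proof -
  obtain \<alpha> \<beta> where ab: "\<alpha> > 0" "\<beta> > 0" "\<alpha> + \<beta> \<le> 2 * (a \<bullet> x)"
    "(1/\<alpha>) *\<^sub>R a \<in> polar C" "- ((1/\<beta>) *\<^sub>R a) \<in> polar C"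
    "\<forall>y\<in>C. a \<bullet> y \<le> \<alpha> \<and> - (a \<bullet> y) \<le> \<beta>" "(a \<bullet> x) * (\<alpha> + \<beta>) \<le> 2 * \<alpha> * \<beta>"
    by (rule harmonic_mean_support[OF C(1,3) a x M])
  have eq: "\<alpha> = a \<bullet> x" "\<beta> = a \<bullet> x"
    using harmonic_mean_le(2)[OF ab(1,2,7,3)] by auto
  have L: "u \<bullet> x - v \<bullet> x \<le> 2" if "u \<in> polar C" "v \<in> polar C" for u v
    using x that by (simp add: mem_polar_half_diff)
  have 0: "0 \<in> C" using C(3) interior_subset by blast
  show "x \<in> C"
  proof (rule mem_of_polar_bound[OF compact_imp_closed[OF C(1)] C(2) 0])
    \<comment> \<open>The polar point v = -a/\<beta> satisfies v \<bullet> x = -1.\<close>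
    show "\<forall>w\<in>polar C. w \<bullet> x \<le> 1"
      using L[OF _ ab(5)] ab(2) unfolding eq by auto
  qed
  show "- x \<in> C"
  proof (rule mem_of_polar_bound[OF compact_imp_closed[OF C(1)] C(2) 0])
    \<comment> \<open>The polar point u = a/\<alpha> satisfies u \<bullet> x = 1.\<close>
    show "\<forall>w\<in>polar C. w \<bullet> (- x) \<le> 1"
      using L[OF ab(4)] ab(1) unfolding eq by auto
  qed
  show "\<forall>y\<in>C. \<bar>a \<bullet> y\<bar> \<le> a \<bullet> x"
    using ab(6) eq by (auto simp: abs_le_iff)
qed

section \<open>Reduction of the three conditions to one antipodal criterion\<close>

lemma opt_contained_intersection_hull_iff:
  fixes C :: "'a::euclidean_space set"
  assumes C: "compact C" "0 \<in> interior C"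
  shows "opt_contained (C \<inter> set_neg C) (convex hull (C \<union> set_neg C)) \<longleftrightarrow>
    (\<exists>p a. a \<noteq> 0 \<and> p \<in> C \<and> - p \<in> C \<and> (\<forall>y\<in>C. \<bar>a \<bullet> y\<bar> \<le> a \<bullet> p))"
    (is "opt_contained ?K ?D \<longleftrightarrow> ?Q")
proof
  assume opt: "opt_contained ?K ?D"
  have "compact ?K"
    using C(1) by (simp add: set_neg_def compact_Int compact_negations)
  moreover have sub: "C \<union> set_neg C \<subseteq> ?D" by (rule hull_subset)
  moreover have "interior ?D \<noteq> {}"
    using C(2) interior_mono[of C ?D] sub by blast
  ultimately obtain a p where ap: "a \<noteq> 0" "p \<in> ?K" "\<forall>x\<in>?D. a \<bullet> x \<le> a \<bullet> p"
    using opt_contained_imp_touching[OF opt] convex_convex_hull by metis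
  have "\<bar>a \<bullet> y\<bar> \<le> a \<bullet> p" if "y \<in> C" for y
  proof -
    have "y \<in> ?D" "- y \<in> ?D" using that sub by auto
    then show ?thesis using ap(3) by (fastforce simp: abs_le_iff)
  qed
  then show ?Q using ap by auto
next
  assume ?Q
  then obtain p a where ap: "a \<noteq> 0" "p \<in> C" "- p \<in> C" "\<forall>y\<in>C. \<bar>a \<bullet> y\<bar> \<le> a \<bullet> p"
    by blast
  have "a \<bullet> p > 0"
    using inner_pos_of_zero_interior[OF C(2) ap(1)] ap(4) by (metis abs_ge_self less_le_trans)
  \<comment> \<open>The slab |a \<bullet> x| \<le> a \<bullet> p is convex and symmetric, so it
    contains the hull once it contains \<open>C\<close>.\<close>
  moreover have "?D \<subseteq> {x. a \<bullet> x \<le> a \<bullet> p} \<inter> {x. a \<bullet> x \<ge> - (a \<bullet> p)}"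
    using ap(4)
    by (intro hull_minimal convex_Int convex_halfspace_le convex_halfspace_ge)
      (fastforce simp: abs_le_iff)
  then have "\<forall>x\<in>?D. \<bar>a \<bullet> x\<bar> \<le> a \<bullet> p" by (auto simp: abs_le_iff)
  moreover have "?K \<subseteq> ?D" using hull_subset[of "C \<union> set_neg C" convex] by blast
  ultimately show "opt_contained ?K ?D"
    using ap by (intro opt_containedI_antipodal[of _ _ p a]) auto
qed

text \<open>Touching points of the two means give the criterion by the equality case. Conversely, p
  and -p lie in the harmonic mean, and the slab bound on \<open>C\<close> passes to the arithmetic
  mean by averaging.\<close>

lemma opt_contained_harmonic_arithmetic_iff:
  fixes C :: "'a::euclidean_space set"
  assumes C: "compact C" "convex C" "0 \<in> interior C"
  shows "opt_contained (polar (dilate (1/2) (minkowski_diff (polar C) (polar C))))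
      (dilate (1/2) (minkowski_diff C C)) \<longleftrightarrow>
    (\<exists>p a. a \<noteq> 0 \<and> p \<in> C \<and> - p \<in> C \<and> (\<forall>y\<in>C. \<bar>a \<bullet> y\<bar> \<le> a \<bullet> p))"
    (is "opt_contained ?L ?M \<longleftrightarrow> ?Q")
proof
  have LM: "?L \<subseteq> ?M" using C by (rule harmonic_mean_subset_arithmetic_mean)
  {
    assume opt: "opt_contained ?L ?M"
    \<comment> \<open>The harmonic mean is closed as a polar and bounded by its inclusion in the
      compact arithmetic mean.\<close>
    have "compact ?L"
      using LM closed_polar compact_half_diff[OF C(1)]
      by (metis compact_Int_closed inf.absorb_iff2)
    moreover have "interior ?M \<noteq> {}"
    proof -
      obtain e where e: "e > 0" "cball 0 e \<subseteq> C"
        using C(3) by (auto simp: mem_interior_cball)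
      have "cball 0 e \<subseteq> ?M"
      proof
        fix y :: 'a assume "y \<in> cball 0 e"
        then have "y \<in> C" "- y \<in> C" using e(2) by (auto simp: subset_iff)
        moreover have "y = (1/2) *\<^sub>R (y - - y)" by (simp flip: scaleR_2)
        ultimately show "y \<in> ?M" unfolding mem_half_diff by blast
      qed
      then have "0 \<in> interior ?M"
        using e(1) unfolding mem_interior_cball by blast
      then show ?thesis by blast
    qed
    ultimately obtain a p where "a \<noteq> 0" "p \<in> ?L" "\<forall>x\<in>?M. a \<bullet> x \<le> a \<bullet> p"
      using opt_contained_imp_touching[OF opt] convex_half_diff[OF C(2)] by metis
    then show ?Q
      using harmonic_mean_touching[OF C] by metis
  }
  assume ?Q
  then obtain p a where ap: "a \<noteq> 0" "p \<in> C" "- p \<in> C" "\<forall>y\<in>C. \<bar>a \<bullet> y\<bar> \<le> a \<bullet> p"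
    by blast
  have "a \<bullet> p > 0"
    using inner_pos_of_zero_interior[OF C(3) ap(1)] ap(4) by (metis abs_ge_self less_le_trans)
  moreover have "\<forall>x\<in>?M. \<bar>a \<bullet> x\<bar> \<le> a \<bullet> p"
  proof
    fix x assume "x \<in> ?M"
    then obtain y z where yz: "y \<in> C" "z \<in> C" "x = (1/2) *\<^sub>R (y - z)"
      by (auto simp: mem_half_diff)
    then have "\<bar>a \<bullet> y\<bar> \<le> a \<bullet> p" "\<bar>a \<bullet> z\<bar> \<le> a \<bullet> p" "2 * (a \<bullet> x) = a \<bullet> y - a \<bullet> z"
      using ap(4) by (auto simp: inner_diff_right)
    then show "\<bar>a \<bullet> x\<bar> \<le> a \<bullet> p" by linarith
  qed
  moreover have "q \<in> ?L" if "q \<in> C" "- q \<in> C" for q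
  proof -
    have "u \<bullet> q - v \<bullet> q \<le> 2" if uv: "u \<in> polar C" "v \<in> polar C" for u v
    proof -
      have "u \<bullet> q \<le> 1" "v \<bullet> (- q) \<le> 1"
        using uv \<open>q \<in> C\<close> \<open>- q \<in> C\<close> unfolding polar_def by blast+
      then show ?thesis by simp
    qed
    then show ?thesis by (simp add: mem_polar_half_diff)
  qed
  ultimately show "opt_contained ?L ?M"
    using ap LM by (intro opt_containedI_antipodal[of _ _ p a]) auto
qed

text \<open>With a common \<rho>, the two halfspaces bound \<open>a\<close> from both sides on
  \<open>C\<close>, and contact at \<open>p\<close> gives \<rho> = a \<bullet> p. Conversely, p and
  -p maximize the nonzero functionals \<open>a\<close> and -a, so neither is interior.\<close>

lemma antipodal_support_iff:
  fixes C :: "'a::euclidean_space set"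
  shows "(\<exists>p a \<rho>. p \<in> frontier C \<and> - p \<in> frontier C \<and> a \<noteq> 0 \<and>
      supports_at (halfspace_le a \<rho>) C p \<and> supports_at (halfspace_le (- a) \<rho>) C (- p)) \<longleftrightarrow>
    (\<exists>p a. a \<noteq> 0 \<and> p \<in> C \<and> - p \<in> C \<and> (\<forall>y\<in>C. \<bar>a \<bullet> y\<bar> \<le> a \<bullet> p))"
proof -
  have supp: "supports_at (halfspace_le a \<rho>) C q \<longleftrightarrow> q \<in> C \<and> (\<forall>y\<in>C. a \<bullet> y \<le> \<rho>) \<and> a \<bullet> q = \<rho>"
    if "a \<noteq> 0" for a q :: 'a and \<rho>
    using that by (auto simp: supports_at_def halfspace_le_def frontier_halfspace_le)
  have front: "q \<in> frontier C" if "a \<noteq> 0" "q \<in> C" "\<forall>y\<in>C. a \<bullet> y \<le> a \<bullet> q" for a q :: 'a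
    using not_interior_of_maximal[OF that(1,3)] that(2) closure_subset
    by (auto simp: frontier_def)
  show ?thesis
  proof
    assume "\<exists>p a \<rho>. p \<in> frontier C \<and> - p \<in> frontier C \<and> a \<noteq> 0 \<and>
      supports_at (halfspace_le a \<rho>) C p \<and> supports_at (halfspace_le (- a) \<rho>) C (- p)"
    then obtain p a \<rho> where "a \<noteq> 0" "supports_at (halfspace_le a \<rho>) C p"
      "supports_at (halfspace_le (- a) \<rho>) C (- p)" by blast
    then have "a \<noteq> 0 \<and> p \<in> C \<and> - p \<in> C \<and> (\<forall>y\<in>C. \<bar>a \<bullet> y\<bar> \<le> a \<bullet> p)"
      by (auto simp: supp abs_le_iff)
    then show "\<exists>p a. a \<noteq> 0 \<and> p \<in> C \<and> - p \<in> C \<and> (\<forall>y\<in>C. \<bar>a \<bullet> y\<bar> \<le> a \<bullet> p)"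
      by blast
  next
    assume "\<exists>p a. a \<noteq> 0 \<and> p \<in> C \<and> - p \<in> C \<and> (\<forall>y\<in>C. \<bar>a \<bullet> y\<bar> \<le> a \<bullet> p)"
    then obtain p a where ap: "a \<noteq> 0" "p \<in> C" "- p \<in> C" "\<forall>y\<in>C. \<bar>a \<bullet> y\<bar> \<le> a \<bullet> p"
      by blast
    have "p \<in> frontier C"
      using ap by (intro front[of a]) (auto simp: abs_le_iff)
    moreover have "- p \<in> frontier C"
      using ap by (intro front[of "- a"]) (auto simp: abs_le_iff)
    moreover have "supports_at (halfspace_le a (a \<bullet> p)) C p"
      using ap by (auto simp: supp abs_le_iff)
    moreover have "supports_at (halfspace_le (- a) (a \<bullet> p)) C (- p)"
      using ap by (auto simp: supp abs_le_iff)
    ultimately show "\<exists>p a \<rho>. p \<in> frontier C \<and> - p \<in> frontier C \<and> a \<noteq> 0 \<and>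
      supports_at (halfspace_le a \<rho>) C p \<and> supports_at (halfspace_le (- a) \<rho>) C (- p)"
      using ap(1) by blast
  qed
qed

theorem theorem1p3:
  fixes C :: "(real ^ 'n) set"
  assumes "convex_body C"
    and "minkowski_centered C"
  shows "(opt_contained (C \<inter> set_neg C) (convex hull (C \<union> set_neg C))
            \<longleftrightarrow> opt_contained (polar (dilate (1/2) (minkowski_diff (polar C) (polar C))))
                  (dilate (1/2) (minkowski_diff C C)))
       \<and> (opt_contained (polar (dilate (1/2) (minkowski_diff (polar C) (polar C))))
              (dilate (1/2) (minkowski_diff C C))
            \<longleftrightarrow> (\<exists>p a \<rho>. p \<in> frontier C \<and> - p \<in> frontier C \<and> a \<noteq> 0 \<and>
                  supports_at (halfspace_le a \<rho>) C p \<and>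
                  supports_at (halfspace_le (- a) \<rho>) C (- p)))"
proof -
  have C: "compact C" "convex C"
    using assms(1) by (auto simp: convex_body_def)
  have 0: "0 \<in> interior C"
    using assms by (rule minkowski_centered_zero_interior)
  show ?thesis
    unfolding antipodal_support_iff opt_contained_intersection_hull_iff[OF C(1) 0]
      opt_contained_harmonic_arithmetic_iff[OF C 0] by simp
qed

end
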